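(* For all integers $n \geq 0$ and all real $x$, $$c_{n+1}(x) = -(n+x)c_n(x) +(-1)^{n+1} n! \sum_{m=0}^n \frac{\widehat{c}_{m+1}}{m!}\binom{x+n}{n-m}$$ and $$\widehat{c}_{n+1}(x) = (x-n)\widehat{c}_n(x) - n! \sum_{m=0}^n \frac{(-1)^m \, c_{m+1}}{m!}\binom{x-m-1}{n-m}.$$
   Context: For real $z$ and integer $n\ge 0$, $\binom{z}{n} = \frac{z(z-1)\cdots(z-n+1)}{n!}$ (with $\binom{z}{0}=1$). The Cauchy polynomials of the first and second kind are $c_n(x) = n! \int_{0}^{1} \binom{t - x}{n}\, dt$ and $\widehat{c}_n(x) = n! \int_{0}^{1} \binom{x - t}{n}\, dt$, $n \ge 0$; the Cauchy numbers are $c_n = c_n(0)$ and $\widehat{c}_n=\widehat{c}_n(0)$. *)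

theory Defs
  imports "HOL-Analysis.Analysis"
begin

definition cauchy_poly1 :: "nat \<Rightarrow> real \<Rightarrow> real" where
  "cauchy_poly1 n x = fact n * integral {0..1} (\<lambda>t. (t - x) gchoose n)"

definition cauchy_poly2 :: "nat \<Rightarrow> real \<Rightarrow> real" where
  "cauchy_poly2 n x = fact n * integral {0..1} (\<lambda>t. (x - t) gchoose n)"

definition cauchy_num1 :: "nat \<Rightarrow> real" where
  "cauchy_num1 n = cauchy_poly1 n 0"

definition cauchy_num2 :: "nat \<Rightarrow> real" where
  "cauchy_num2 n = cauchy_poly2 n 0"

end

(*
  Peel the last factor off the falling factorial of length n + 1 in the integrand: this reduces
  both recurrences to evaluating the integral of t * binom(t - x, n), respectively of
  t * binom(x - t, n). Expand these binomials by Vandermonde's identity in the basis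
  binom(-t - 1, m), respectively binom(t - 1, m), and absorb the factor t to recognise the
  integrands of the Cauchy numbers.
*)

theory Submission
  imports Defs
begin

lemma continuous_on_gbinomial [continuous_intros]:
  fixes f :: "'a::topological_space \<Rightarrow> real"
  assumes "continuous_on S f"
  shows "continuous_on S (\<lambda>t. f t gchoose n)"
  unfolding gbinomial_prod_rev by (intro continuous_intros assms) auto

lemma gbinomial_Vandermonde_real:
  fixes a b :: real
  shows "(\<Sum>m=0..n. (a gchoose m) * (b gchoose (n - m))) = (a + b) gchoose n"
  using gbinomial_Vandermonde[of a b n] by simp

lemma fact_Suc_mult_gbinomial_Suc:
  fixes a :: real
  shows "fact (n + 1) * (a gchoose (n + 1)) = fact n * ((a - real n) * (a gchoose n))"
  using gbinomial_mult_1[of a n] by (simp add: algebra_simps)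

lemma integrable_Cauchy_integrands:
  fixes f :: "real \<Rightarrow> real"
  assumes "continuous_on {0..1} f"
  shows "(\<lambda>t. f t gchoose n) integrable_on {0..1}"
    and "(\<lambda>t. t * (f t gchoose n)) integrable_on {0..1}"
  by (intro integrable_continuous_real continuous_intros assms)+

text \<open>The peeled factor is \<open>(t - x) - real n = t - (real n + x)\<close>: its part free
  of \<open>t\<close> reproduces \<open>cauchy_poly1 n x\<close>, and its part \<open>t\<close>
  leaves the integral still to be evaluated.\<close>

lemma cauchy_poly1_Suc:
  "cauchy_poly1 (n + 1) x =
    - (real n + x) * cauchy_poly1 n x + fact n * integral {0..1} (\<lambda>t. t * ((t - x) gchoose n))"
proof -
  have "cauchy_poly1 (n + 1) x =
      integral {0..1} (\<lambda>t. fact n * (t * ((t - x) gchoose n) - (real n + x) * ((t - x) gchoose n)))"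
    unfolding cauchy_poly1_def integral_mult_right[symmetric] fact_Suc_mult_gbinomial_Suc
    by (simp add: algebra_simps)
  also have "\<dots> = fact n * (integral {0..1} (\<lambda>t. t * ((t - x) gchoose n)) -
      (real n + x) * integral {0..1} (\<lambda>t. (t - x) gchoose n))"
    by (subst integral_mult_right, subst integral_diff)
       (auto intro!: integrable_Cauchy_integrands integrable_on_mult_right continuous_intros)
  finally show ?thesis
    by (simp add: cauchy_poly1_def algebra_simps)
qed

text \<open>Here the peeled factor is \<open>(x - t) - real n = (x - real n) - t\<close>, so the
  remaining integral enters with a minus sign.\<close>

lemma cauchy_poly2_Suc:
  "cauchy_poly2 (n + 1) x =
    (x - real n) * cauchy_poly2 n x - fact n * integral {0..1} (\<lambda>t. t * ((x - t) gchoose n))"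
proof -
  have "cauchy_poly2 (n + 1) x =
      integral {0..1} (\<lambda>t. fact n * ((x - real n) * ((x - t) gchoose n) - t * ((x - t) gchoose n)))"
    unfolding cauchy_poly2_def integral_mult_right[symmetric] fact_Suc_mult_gbinomial_Suc
    by (simp add: algebra_simps)
  also have "\<dots> = fact n * ((x - real n) * integral {0..1} (\<lambda>t. (x - t) gchoose n) -
      integral {0..1} (\<lambda>t. t * ((x - t) gchoose n)))"
    by (subst integral_mult_right, subst integral_diff)
       (auto intro!: integrable_Cauchy_integrands integrable_on_mult_right continuous_intros)
  finally show ?thesis
    by (simp add: cauchy_poly2_def algebra_simps)
qed

text \<open>The quotient of factorials leaves a factor \<open>m + 1\<close>, which absorption trades
  for the upper entry \<open>t\<close> while lowering both entries by one.\<close>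

lemma cauchy_num1_Suc:
  "cauchy_num1 (m + 1) / fact m = integral {0..1} (\<lambda>t. t * ((t - 1) gchoose m))"
proof -
  have "cauchy_num1 (m + 1) / fact m = integral {0..1} (\<lambda>t. real (Suc m) * (t gchoose Suc m))"
    by (simp add: cauchy_num1_def cauchy_poly1_def)
  then show ?thesis
    by (simp only: gbinomial_absorption)
qed

text \<open>Absorption now extracts the upper entry \<open>- t\<close>; this is the source of the
  minus sign.\<close>

lemma cauchy_num2_Suc:
  "cauchy_num2 (m + 1) / fact m = - integral {0..1} (\<lambda>t. t * ((- t - 1) gchoose m))"
proof -
  have "cauchy_num2 (m + 1) / fact m = integral {0..1} (\<lambda>t. real (Suc m) * (- t gchoose Suc m))"
    by (simp add: cauchy_num2_def cauchy_poly2_def)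
  then show ?thesis
    by (simp only: gbinomial_absorption) simp
qed

text \<open>Brings the sum under the integral with \<open>t\<close> factored out, so that
  Vandermonde applies pointwise in \<open>t\<close>; the weights \<open>g m\<close> will be the
  complementary binomials.\<close>

lemma integral_sum_gbinomial:
  fixes f :: "real \<Rightarrow> real" and g :: "nat \<Rightarrow> real"
  assumes "continuous_on {0..1} f"
  shows "(\<Sum>m=0..n. integral {0..1} (\<lambda>t. t * (f t gchoose m)) * g m) =
    integral {0..1} (\<lambda>t. t * (\<Sum>m=0..n. (f t gchoose m) * g m))"
proof -
  have "integral {0..1} (\<lambda>t. \<Sum>m=0..n. t * (f t gchoose m) * g m) =
      (\<Sum>m=0..n. integral {0..1} (\<lambda>t. t * (f t gchoose m) * g m))"
    by (intro integral_sum) (auto intro!: integrable_Cauchy_integrands integrable_on_mult_left assms)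
  then show ?thesis
    by (simp add: sum_distrib_left flip: mult.assoc)
qed

lemma sum_cauchy_num2:
  "(\<Sum>m=0..n. cauchy_num2 (m + 1) / fact m * ((x + real n) gchoose (n - m))) =
    (- 1) ^ (n + 1) * integral {0..1} (\<lambda>t. t * ((t - x) gchoose n))"
proof -
  \<comment> \<open>Negating the upper entry \<open>a\<close> turns it into
    \<open>n - a - 1\<close>, which is \<open>t - x\<close> for the upper entry that Vandermonde
    produces.\<close>
  have reflect: "((- t - 1) + (x + real n)) gchoose n = (- 1) ^ n * ((t - x) gchoose n)" for t
    using gbinomial_negated_upper[of "(- t - 1) + (x + real n)" n] by (simp add: algebra_simps)
  have "(\<Sum>m=0..n. cauchy_num2 (m + 1) / fact m * ((x + real n) gchoose (n - m))) =
      - (\<Sum>m=0..n. integral {0..1} (\<lambda>t. t * ((- t - 1) gchoose m)) * ((x + real n) gchoose (n - m)))"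
    unfolding cauchy_num2_Suc by (simp add: sum_negf)
  also have "\<dots> = - integral {0..1} (\<lambda>t. t * (((- t - 1) + (x + real n)) gchoose n))"
    by (subst integral_sum_gbinomial)
       (auto intro!: continuous_intros simp only: gbinomial_Vandermonde_real)
  also have "\<dots> = - integral {0..1} (\<lambda>t. (- 1) ^ n * (t * ((t - x) gchoose n)))"
    unfolding reflect by (simp only: mult.left_commute)
  finally show ?thesis
    by simp
qed

text \<open>Vandermonde does not apply directly, because the upper entry
  \<open>x - real m - 1\<close> varies with \<open>m\<close>. Negating it gives
  \<open>real n - x\<close>, free of \<open>m\<close>, and the resulting sign merges with
  \<open>(- 1) ^ m\<close> into \<open>(- 1) ^ n\<close>.\<close>

lemma sum_cauchy_num1:
  "(\<Sum>m=0..n. (- 1) ^ m * cauchy_num1 (m + 1) / fact m * ((x - real m - 1) gchoose (n - m))) =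
    integral {0..1} (\<lambda>t. t * ((x - t) gchoose n))"
proof -
  have reflect: "((t - 1) + (real n - x)) gchoose n = (- 1) ^ n * ((x - t) gchoose n)" for t
    using gbinomial_negated_upper[of "(t - 1) + (real n - x)" n] by (simp add: algebra_simps)
  have "(- 1) ^ m * cauchy_num1 (m + 1) / fact m * ((x - real m - 1) gchoose (n - m)) =
      (- 1) ^ n * (integral {0..1} (\<lambda>t. t * ((t - 1) gchoose m)) * ((real n - x) gchoose (n - m)))"
    if "m \<in> {0..n}" for m
  proof -
    \<comment> \<open>The \<open>m\<close> cancels in
      \<open>(n - m) - (x - m - 1) - 1 = n - x\<close>, where m \<le> n makes the natural
      subtraction exact.\<close>
    have "(x - real m - 1) gchoose (n - m) = (- 1) ^ (n - m) * ((real n - x) gchoose (n - m))"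
      using that gbinomial_negated_upper[of "x - real m - 1" "n - m"] by (simp add: of_nat_diff)
    moreover have "(- 1) ^ n = (- 1) ^ m * (- 1 :: real) ^ (n - m)"
      using that by (simp flip: power_add)
    ultimately show ?thesis
      unfolding cauchy_num1_Suc[symmetric] by simp
  qed
  then have "(\<Sum>m=0..n. (- 1) ^ m * cauchy_num1 (m + 1) / fact m * ((x - real m - 1) gchoose (n - m))) =
      (- 1) ^ n * (\<Sum>m=0..n. integral {0..1} (\<lambda>t. t * ((t - 1) gchoose m)) * ((real n - x) gchoose (n - m)))"
    by (simp only: sum_distrib_left cong: sum.cong)
  also have "\<dots> = (- 1) ^ n * integral {0..1} (\<lambda>t. t * (((t - 1) + (real n - x)) gchoose n))"
    by (subst integral_sum_gbinomial)
       (auto intro!: continuous_intros simp only: gbinomial_Vandermonde_real)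
  also have "\<dots> = (- 1) ^ n * integral {0..1} (\<lambda>t. (- 1) ^ n * (t * ((x - t) gchoose n)))"
    unfolding reflect by (simp only: mult.left_commute)
  finally show ?thesis
    \<comment> \<open>The signs \<open>(- 1) ^ n\<close> from the two reflections cancel.\<close>
    by (simp only: integral_mult_right) (simp flip: mult.assoc power_mult_distrib)
qed

theorem theorem3:
  fixes n :: nat and x :: real
  shows "cauchy_poly1 (n + 1) x =
           - (real n + x) * cauchy_poly1 n x
           + (- 1) ^ (n + 1) * fact n *
             (\<Sum>m=0..n. cauchy_num2 (m + 1) / fact m * ((x + real n) gchoose (n - m)))
       \<and> cauchy_poly2 (n + 1) x =
           (x - real n) * cauchy_poly2 n x
           - fact n *
             (\<Sum>m=0..n. (- 1) ^ m * cauchy_num1 (m + 1) / fact m * ((x - real m - 1) gchoose (n - m)))"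
proof
  \<comment> \<open>The sign in front of the sum cancels the one that \<open>sum_cauchy_num2\<close>
    yields.\<close>
  have "(- 1) ^ (n + 1) * fact n * ((- 1) ^ (n + 1) * y) = fact n * y" for y :: real
    by (simp add: mult.left_commute flip: power_mult_distrib mult.assoc)
  then show "cauchy_poly1 (n + 1) x =
      - (real n + x) * cauchy_poly1 n x
      + (- 1) ^ (n + 1) * fact n *
        (\<Sum>m=0..n. cauchy_num2 (m + 1) / fact m * ((x + real n) gchoose (n - m)))"
    unfolding cauchy_poly1_Suc sum_cauchy_num2 by simp
next
  show "cauchy_poly2 (n + 1) x =
      (x - real n) * cauchy_poly2 n x
      - fact n *
        (\<Sum>m=0..n. (- 1) ^ m * cauchy_num1 (m + 1) / fact m * ((x - real m - 1) gchoose (n - m)))"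
    unfolding cauchy_poly2_Suc sum_cauchy_num1 by simp
qed

end
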